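(* Let $G$ and $H$ be connected graphs. Then $$D(H)\leq D(G[H])\leq D(G)\cdot D(H).$$
   Context: All graphs are finite and simple. For a graph $X$, a vertex labeling $\phi:V(X)\to\{1,\dots,r\}$ is $r$-distinguishing if the only automorphism of $X$ preserving all vertex labels (i.e. $\phi(\sigma x)=\phi(x)$ for all $x$) is the identity. The distinguishing number $D(X)$ is the least $r$ such that $X$ has an $r$-distinguishing vertex labeling. The lexicographic product $G[H]$ has vertex set $V(G)\times V(H)$, with $(a,x)$ adjacent to $(b,y)$ if and only if $ab\in E(G)$, or $a=b$ and $xy\in E(H)$. *)

theory Defs
  imports "Graph_Theory.Graph_Theory" "HOL-Combinatorics.Permutations" "HOL-Library.FuncSet"
begin

text \<open>
  A finite simple graph is a \<^const>\<open>pair_graph\<close>: finite vertex set, and a symmetric,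
  irreflexive set of arcs, each edge \<open>uv\<close> being the two arcs \<open>(u,v)\<close> and \<open>(v,u)\<close>.
\<close>

text \<open>
  Since \<open>permutes\<close> fixes every point outside the vertex set, the identity automorphism is
  exactly \<^const>\<open>id\<close>.
\<close>

definition graph_automorphism :: "'a pair_pre_digraph \<Rightarrow> ('a \<Rightarrow> 'a) \<Rightarrow> bool" where
  "graph_automorphism X \<sigma> \<longleftrightarrow> \<sigma> permutes pverts X \<and>
     (\<forall>x \<in> pverts X. \<forall>y \<in> pverts X. (\<sigma> x, \<sigma> y) \<in> parcs X \<longleftrightarrow> (x, y) \<in> parcs X)"

definition distinguishing_labeling :: "'a pair_pre_digraph \<Rightarrow> nat \<Rightarrow> ('a \<Rightarrow> nat) \<Rightarrow> bool" where
  "distinguishing_labeling X r \<phi> \<longleftrightarrow> \<phi> \<in> pverts X \<rightarrow> {1..r} \<and>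
     (\<forall>\<sigma>. graph_automorphism X \<sigma> \<and> (\<forall>x \<in> pverts X. \<phi> (\<sigma> x) = \<phi> x) \<longrightarrow> \<sigma> = id)"

definition distinguishing_number :: "'a pair_pre_digraph \<Rightarrow> nat" where
  "distinguishing_number X = (LEAST r. \<exists>\<phi>. distinguishing_labeling X r \<phi>)"

definition lex_product ::
  "'a pair_pre_digraph \<Rightarrow> 'b pair_pre_digraph \<Rightarrow> ('a \<times> 'b) pair_pre_digraph" where
  "lex_product G H =
    \<lparr> pverts = pverts G \<times> pverts H,
      parcs = {((a, x), (b, y)) | a x b y.
        (a, x) \<in> pverts G \<times> pverts H \<and> (b, y) \<in> pverts G \<times> pverts H \<and>
        ((a, b) \<in> parcs G \<or> a = b \<and> (x, y) \<in> parcs H)} \<rparr>"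

lemma pair_graph_lex_product:
  assumes "pair_graph G" "pair_graph H"
  shows "pair_graph (lex_product G H)"
proof -
  interpret G: pair_graph G by fact
  interpret H: pair_graph H by fact
  have sub: "parcs (lex_product G H) \<subseteq> (pverts G \<times> pverts H) \<times> (pverts G \<times> pverts H)"
    by (auto simp: lex_product_def)
  have fin: "finite (parcs (lex_product G H))"
    using finite_subset[OF sub] G.pair_finite_verts H.pair_finite_verts by blast
  have symG: "(b, a) \<in> parcs G" if "(a, b) \<in> parcs G" for a b
    using G.pair_sym_arcs that by (auto simp: symmetric_def dest: symD)
  have symH: "(y, x) \<in> parcs H" if "(x, y) \<in> parcs H" for x y
    using H.pair_sym_arcs that by (auto simp: symmetric_def dest: symD)
  show ?thesis
  proof
    show "finite (pverts (lex_product G H))"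
      by (simp add: lex_product_def G.pair_finite_verts H.pair_finite_verts)
    show "symmetric (with_proj (lex_product G H))"
      unfolding symmetric_def with_proj_simps
      by (rule symI) (auto simp: lex_product_def intro: symG symH)
    show "fst e \<noteq> snd e" if "e \<in> parcs (lex_product G H)" for e
      using that by (auto simp: lex_product_def dest: G.pair_no_loops H.pair_no_loops)
  qed (use sub fin in \<open>auto simp: lex_product_def\<close>)
qed

lemma distinguishing_number_attained:
  assumes "finite (pverts X)"
  shows "\<exists>\<phi>. distinguishing_labeling X (distinguishing_number X) \<phi>"
proof -
  obtain f where f: "bij_betw f (pverts X) {1..card (pverts X)}"
    using finite_same_card_bij[of "pverts X" "{1..card (pverts X)}"] assms by auto
  have "\<sigma> = id" if "\<sigma> permutes pverts X" "\<forall>x \<in> pverts X. f (\<sigma> x) = f x" for \<sigma>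
  proof
    fix x
    show "\<sigma> x = id x"
    proof (cases "x \<in> pverts X")
      case True
      then show ?thesis
        using inj_onD[OF bij_betw_imp_inj_on[OF f], of "\<sigma> x" x] that permutes_in_image[OF that(1)]
        by simp
    next
      case False
      then show ?thesis
        using that(1) by (simp add: permutes_not_in)
    qed
  qed
  then have "distinguishing_labeling X (card (pverts X)) f"
    using f by (auto simp: distinguishing_labeling_def graph_automorphism_def bij_betw_def)
  then show ?thesis
    unfolding distinguishing_number_def
    by (intro LeastI[where P = "\<lambda>r. \<exists>\<phi>. distinguishing_labeling X r \<phi>"] exI)
qed

end

theory Submission
  imports Defs
begin

text \<open>
  For the lower bound, restrict a distinguishing labeling of \<open>G[H]\<close> to one fibre \<open>{a} \<times> H\<close>:
  an automorphism of the fibre extends to \<open>G[H]\<close> by the identity.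

  For the upper bound, label \<open>(a, x)\<close> by the pair of labels of \<open>a\<close> and \<open>x\<close>, and let \<open>\<sigma>\<close> be an
  automorphism of \<open>G[H]\<close> preserving this labeling. If \<open>\<sigma>\<close> sent two points of the fibre over \<open>a\<close>
  to fibres over \<open>c \<noteq> d\<close>, then \<open>c\<close> and \<open>d\<close> would have equal labels, so they are not twins (twins
  could be swapped), and some third vertex \<open>e\<close> is adjacent to exactly one of them. A preimage of
  a point over \<open>e\<close> then separates two points over \<open>a\<close>, which only a point over \<open>a\<close> can do;
  hence \<open>\<sigma>\<close> maps the fibre over \<open>a\<close> onto the fibre over \<open>e\<close>, contradicting \<open>e \<noteq> c\<close>.
  So \<open>\<sigma>\<close> maps fibres to fibres, and the action on \<open>G\<close> and the action inside each fibre
  are label-preserving automorphisms, hence trivial.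
\<close>

section \<open>Elementary facts about graphs, products and labelings\<close>

lemma pair_graph_arc_commute:
  assumes "pair_graph X"
  shows "(x, y) \<in> parcs X \<longleftrightarrow> (y, x) \<in> parcs X"
proof -
  interpret pair_graph X by fact
  show ?thesis
    using pair_sym_arcs by (auto simp: symmetric_def dest: symD)
qed

lemma pair_graph_no_loop:
  assumes "pair_graph X"
  shows "(x, x) \<notin> parcs X"
proof -
  interpret pair_graph X by fact
  show ?thesis
    using pair_no_loops by force
qed

lemma pair_graph_finite_pverts:
  assumes "pair_graph X"
  shows "finite (pverts X)"
proof -
  interpret pair_graph X by fact
  show ?thesis
    by (rule pair_finite_verts)
qed

lemma pverts_lex_product [simp]: "pverts (lex_product G H) = pverts G \<times> pverts H"
  by (simp add: lex_product_def)

lemma parcs_lex_product_iff: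
  assumes "a \<in> pverts G" "b \<in> pverts G" "x \<in> pverts H" "y \<in> pverts H"
  shows "((a, x), (b, y)) \<in> parcs (lex_product G H) \<longleftrightarrow>
    (a, b) \<in> parcs G \<or> a = b \<and> (x, y) \<in> parcs H"
  using assms by (simp add: lex_product_def)

lemma distinguishing_number_le:
  "distinguishing_labeling X r \<phi> \<Longrightarrow> distinguishing_number X \<le> r"
  unfolding distinguishing_number_def by (rule Least_le) blast

lemma distinguishing_labelingD:
  assumes "distinguishing_labeling X r \<phi>" "graph_automorphism X \<sigma>"
    and "\<And>x. x \<in> pverts X \<Longrightarrow> \<phi> (\<sigma> x) = \<phi> x"
  shows "\<sigma> = id"
  using assms by (simp add: distinguishing_labeling_def)

lemma graph_automorphismD:
  assumes "graph_automorphism X \<sigma>" "x \<in> pverts X" "y \<in> pverts X"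
  shows "(\<sigma> x, \<sigma> y) \<in> parcs X \<longleftrightarrow> (x, y) \<in> parcs X"
  using assms by (simp add: graph_automorphism_def)

lemma graph_automorphism_permutes: "graph_automorphism X \<sigma> \<Longrightarrow> \<sigma> permutes pverts X"
  by (simp add: graph_automorphism_def)

section \<open>Automorphisms from maps specified on the vertices only\<close>

text \<open>An injective self-map of a finite set is bijective. The identity branch is there because
  \<open>permutes\<close> demands that points outside the vertex set stay fixed.\<close>

lemma graph_automorphism_restrictI:
  assumes "finite (pverts X)" "f \<in> pverts X \<rightarrow> pverts X"
    and "inj_on f (pverts X)"
    and "\<And>x y. x \<in> pverts X \<Longrightarrow> y \<in> pverts X \<Longrightarrow> (f x, f y) \<in> parcs X \<longleftrightarrow> (x, y) \<in> parcs X"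
  shows "graph_automorphism X (\<lambda>x. if x \<in> pverts X then f x else x)"
proof -
  have "bij_betw f (pverts X) (pverts X)"
    using assms(1-3) endo_inj_surj[of "pverts X" f] by (auto simp: bij_betw_def)
  then have "bij_betw (\<lambda>x. if x \<in> pverts X then f x else x) (pverts X) (pverts X)"
    by (simp cong: bij_betw_cong)
  then show ?thesis
    using assms(4) by (auto simp: graph_automorphism_def intro: bij_imp_permutes)
qed

text \<open>The form in which distinguishing labelings are applied below: \<open>f\<close> may be
  arbitrary outside the vertices, so projections of product automorphisms can be plugged in
  directly.\<close>

lemma distinguishing_labeling_trivial_on:
  assumes "distinguishing_labeling X r \<phi>"
    and "finite (pverts X)" "f \<in> pverts X \<rightarrow> pverts X" "inj_on f (pverts X)"
    and "\<And>x y. x \<in> pverts X \<Longrightarrow> y \<in> pverts X \<Longrightarrow> (f x, f y) \<in> parcs X \<longleftrightarrow> (x, y) \<in> parcs X"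
    and "\<And>x. x \<in> pverts X \<Longrightarrow> \<phi> (f x) = \<phi> x"
    and "x \<in> pverts X"
  shows "f x = x"
proof -
  have "(\<lambda>x. if x \<in> pverts X then f x else x) = id"
    using graph_automorphism_restrictI[OF assms(2-5)]
    by (rule distinguishing_labelingD[OF assms(1)]) (simp_all add: assms(6))
  then have "(\<lambda>x. if x \<in> pverts X then f x else x) x = id x"
    by (rule fun_cong)
  then show ?thesis
    using assms(7) by simp
qed

section \<open>Equally labelled vertices are not twins\<close>

text \<open>Otherwise the transposition of \<open>c\<close> and \<open>d\<close> would be a
  nontrivial label-preserving automorphism. Excluding \<open>c\<close> and \<open>d\<close> as
  values of \<open>e\<close> matters: if they are adjacent, each of them already meets the last
  condition.\<close>

lemma distinguishing_labeling_separates: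
  assumes X: "pair_graph X" and \<phi>: "distinguishing_labeling X r \<phi>"
    and cd: "c \<in> pverts X" "d \<in> pverts X" "c \<noteq> d" "\<phi> c = \<phi> d"
  obtains e where "e \<in> pverts X" "e \<noteq> c" "e \<noteq> d" "(e, c) \<in> parcs X \<longleftrightarrow> (e, d) \<notin> parcs X"
proof (rule ccontr)
  assume "\<not> thesis"
  with that have twins: "(e, c) \<in> parcs X \<longleftrightarrow> (e, d) \<in> parcs X"
    if "e \<in> pverts X" "e \<noteq> c" "e \<noteq> d" for e
    using \<open>e \<in> pverts X\<close> \<open>e \<noteq> c\<close> \<open>e \<noteq> d\<close> by blast
  have twins': "(c, e) \<in> parcs X \<longleftrightarrow> (d, e) \<in> parcs X"
    if "e \<in> pverts X" "e \<noteq> c" "e \<noteq> d" for e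
    using twins[OF that] pair_graph_arc_commute[OF X] by blast
  have "transpose c d c = c"
  proof (rule distinguishing_labeling_trivial_on[OF \<phi> pair_graph_finite_pverts[OF X],
        where f = "transpose c d" and x = c])
    show "(transpose c d x, transpose c d y) \<in> parcs X \<longleftrightarrow> (x, y) \<in> parcs X"
      if xy: "x \<in> pverts X" "y \<in> pverts X" for x y
    proof -
      \<comment> \<open>The transposition exchanges the arcs between \<open>c\<close> and
        \<open>d\<close>, which symmetry handles, and the pairs \<open>(c, c)\<close> and
        \<open>(d, d)\<close>, neither of which is an arc; all other pairs are covered by
        \<open>twins\<close> and \<open>twins'\<close>.\<close>
      have cd_arc: "(c, d) \<in> parcs X \<longleftrightarrow> (d, c) \<in> parcs X"
        by (rule pair_graph_arc_commute[OF X])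
      note loop = pair_graph_no_loop[OF X]
      consider "x = c" | "x = d" | "x \<noteq> c" "x \<noteq> d" by blast
      then show ?thesis
      proof cases
        case 1
        then show ?thesis
          using cd_arc loop twins'[OF xy(2)] by (cases "y = c"; cases "y = d") simp_all
      next
        case 2
        then show ?thesis
          using cd_arc loop twins'[OF xy(2)] by (cases "y = c"; cases "y = d") simp_all
      next
        case 3
        then show ?thesis
          using twins[OF xy(1)] by (cases "y = c"; cases "y = d") simp_all
      qed
    qed
  qed (use cd in \<open>auto simp: transpose_def\<close>)
  then show False
    using cd(3) by simp
qed

section \<open>Lower bound: restriction to a fibre\<close>

text \<open>Adjacency between different fibres ignores second coordinates, so applying
  \<open>\<sigma>\<close> in the fibre over \<open>a\<close> alone preserves all arcs of the
  product.\<close>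

lemma distinguishing_labeling_lex_product_fibre:
  assumes G: "pair_graph G" and H: "pair_graph H" and a: "a \<in> pverts G"
    and \<psi>: "distinguishing_labeling (lex_product G H) r \<psi>"
  shows "distinguishing_labeling H r (\<lambda>x. \<psi> (a, x))"
  unfolding distinguishing_labeling_def
proof (intro conjI allI impI)
  show "(\<lambda>x. \<psi> (a, x)) \<in> pverts H \<rightarrow> {1..r}"
    using \<psi> a by (auto simp: distinguishing_labeling_def Pi_iff)
next
  fix \<sigma>
  assume \<sigma>: "graph_automorphism H \<sigma> \<and> (\<forall>x\<in>pverts H. \<psi> (a, \<sigma> x) = \<psi> (a, x))"
  then have perm: "\<sigma> permutes pverts H"
    by (simp add: graph_automorphism_def)
  note aut = graph_automorphismD[OF conjunct1[OF \<sigma>]]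
  define f where "f = (\<lambda>(b, x). (b, if b = a then \<sigma> x else x))"
  have "f (a, x) = (a, x)" if "x \<in> pverts H" for x
  proof (rule distinguishing_labeling_trivial_on[OF \<psi>, where f = f])
    show "finite (pverts (lex_product G H))"
      using pair_graph_finite_pverts[OF G] pair_graph_finite_pverts[OF H] by simp
    show "inj_on f (pverts (lex_product G H))"
      by (auto simp: f_def inj_on_def inj_eq[OF permutes_inj[OF perm]] split: if_splits)
    show "f \<in> pverts (lex_product G H) \<rightarrow> pverts (lex_product G H)"
      by (auto simp: f_def permutes_in_image[OF perm])
    show "(f p, f q) \<in> parcs (lex_product G H) \<longleftrightarrow> (p, q) \<in> parcs (lex_product G H)"
      if "p \<in> pverts (lex_product G H)" "q \<in> pverts (lex_product G H)" for p q
      using that by (auto simp: f_def parcs_lex_product_iff permutes_in_image[OF perm] aut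
          split: if_splits)
    show "\<psi> (f p) = \<psi> p" if "p \<in> pverts (lex_product G H)" for p
      using that \<sigma> by (auto simp: f_def)
  qed (use a that in simp)
  then have "\<sigma> x = x" if "x \<in> pverts H" for x
    using that by (simp add: f_def)
  then show "\<sigma> = id"
    using permutes_not_in[OF perm] by fastforce
qed

section \<open>Upper bound: automorphisms preserving both coordinate labels\<close>

lemma lex_product_automorphism_fibres:
  assumes G: "pair_graph G" and H: "pair_graph H"
    and \<phi>: "distinguishing_labeling G r \<phi>"
    and \<sigma>: "graph_automorphism (lex_product G H) \<sigma>"
    and lab: "\<And>p. p \<in> pverts (lex_product G H) \<Longrightarrow> \<phi> (fst (\<sigma> p)) = \<phi> (fst p)"
    and a: "a \<in> pverts G" and xy: "x \<in> pverts H" "y \<in> pverts H"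
  shows "fst (\<sigma> (a, x)) = fst (\<sigma> (a, y))"
proof (rule ccontr)
  assume "fst (\<sigma> (a, x)) \<noteq> fst (\<sigma> (a, y))"
  moreover obtain c u d v where cu: "\<sigma> (a, x) = (c, u)" and dv: "\<sigma> (a, y) = (d, v)"
    by fastforce
  ultimately have "c \<noteq> d" by simp
  note perm = graph_automorphism_permutes[OF \<sigma>]
  have vs: "c \<in> pverts G" "u \<in> pverts H" "d \<in> pverts G" "v \<in> pverts H"
    using permutes_in_image[OF perm, of "(a, x)"] permutes_in_image[OF perm, of "(a, y)"]
    by (simp_all add: a xy cu dv)
  have "\<phi> c = \<phi> d"
    using lab[of "(a, x)"] lab[of "(a, y)"] by (simp add: a xy cu dv)
  then obtain e where e: "e \<in> pverts G" "e \<noteq> c" "e \<noteq> d" "(e, c) \<in> parcs G \<longleftrightarrow> (e, d) \<notin> parcs G"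
    using distinguishing_labeling_separates[OF G \<phi> vs(1,3) \<open>c \<noteq> d\<close>] by blast
  have "inv \<sigma> ` ({e} \<times> pverts H) \<subseteq> {a} \<times> pverts H"
  proof (rule image_subsetI)
    fix p assume "p \<in> {e} \<times> pverts H"
    then obtain w where p: "p = (e, w)" "w \<in> pverts H"
      by auto
    obtain b z where bz: "inv \<sigma> p = (b, z)"
      by fastforce
    then have \<sigma>bz: "\<sigma> (b, z) = (e, w)"
      using permutes_inverses(1)[OF perm] p by metis
    then have "b \<in> pverts G" "z \<in> pverts H"
      using permutes_in_image[OF perm, of "(b, z)"] by (simp_all add: e p)
    \<comment> \<open>Both sides express adjacency before and after applying
      \<open>\<sigma>\<close>. On the right only the \<open>G\<close> part survives, since
      \<open>e\<close> differs from \<open>c\<close> and \<open>d\<close>.\<close>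
    then have "((b, a) \<in> parcs G \<or> b = a \<and> (z, x) \<in> parcs H) \<longleftrightarrow> (e, c) \<in> parcs G"
      "((b, a) \<in> parcs G \<or> b = a \<and> (z, y) \<in> parcs H) \<longleftrightarrow> (e, d) \<in> parcs G"
      using graph_automorphismD[OF \<sigma>, of "(b, z)" "(a, x)"]
        graph_automorphismD[OF \<sigma>, of "(b, z)" "(a, y)"]
      by (simp_all add: \<sigma>bz cu dv parcs_lex_product_iff a xy vs e p)
    \<comment> \<open>For \<open>b \<noteq> a\<close> both left-hand sides reduce to
      \<open>(b, a) \<in> parcs G\<close>, whereas the right-hand sides disagree by the choice of
      \<open>e\<close>.\<close>
    then show "inv \<sigma> p \<in> {a} \<times> pverts H"
      using e(4) \<open>z \<in> pverts H\<close> bz by auto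
  qed
  moreover have "finite ({a} \<times> pverts H)"
    using H by (simp add: pair_graph_finite_pverts)
  \<comment> \<open>All fibres have the size of \<open>H\<close>, so the inclusion is an equality,
    and \<open>(a, x)\<close> itself must be mapped into the fibre over \<open>e\<close>.\<close>
  moreover have "card (inv \<sigma> ` ({e} \<times> pverts H)) = card ({a} \<times> pverts H)"
    using permutes_inj_on[OF permutes_inv[OF perm]]
    by (simp add: card_image card_cartesian_product)
  ultimately have "inv \<sigma> ` ({e} \<times> pverts H) = {a} \<times> pverts H"
    by (intro card_subset_eq)
  then have "(a, x) \<in> inv \<sigma> ` ({e} \<times> pverts H)"
    using xy(1) by simp
  then obtain w where "inv \<sigma> (e, w) = (a, x)"
    by auto
  then have "\<sigma> (a, x) = (e, w)"
    using permutes_inverses(1)[OF perm] by metis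
  then show False
    using cu e(2) by simp
qed

lemma lex_product_automorphism_trivial:
  assumes G: "pair_graph G" and H: "pair_graph H"
    and \<phi>: "distinguishing_labeling G r \<phi>" and \<chi>: "distinguishing_labeling H s \<chi>"
    and \<sigma>: "graph_automorphism (lex_product G H) \<sigma>"
    and lab1: "\<And>p. p \<in> pverts (lex_product G H) \<Longrightarrow> \<phi> (fst (\<sigma> p)) = \<phi> (fst p)"
    and lab2: "\<And>p. p \<in> pverts (lex_product G H) \<Longrightarrow> \<chi> (snd (\<sigma> p)) = \<chi> (snd p)"
  shows "\<sigma> = id"
proof
  fix p
  note perm = graph_automorphism_permutes[OF \<sigma>]
  have \<sigma>_in: "fst (\<sigma> (a, x)) \<in> pverts G" "snd (\<sigma> (a, x)) \<in> pverts H"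
    if "a \<in> pverts G" "x \<in> pverts H" for a x
    using permutes_in_image[OF perm, of "(a, x)"] that by (auto simp: mem_Times_iff)
  have finG: "finite (pverts G)" and finH: "finite (pverts H)"
    using G H by (simp_all add: pair_graph_finite_pverts)
  have fibre: "fst (\<sigma> (a, x)) = fst (\<sigma> (a, y))"
    if "a \<in> pverts G" "x \<in> pverts H" "y \<in> pverts H" for a x y
    by (rule lex_product_automorphism_fibres[OF G H \<phi> \<sigma>]) (fact lab1 that)+
  show "\<sigma> p = id p"
  proof (cases "p \<in> pverts (lex_product G H)")
    case False
    then show ?thesis
      using permutes_not_in[OF perm] by simp
  next
    case True
    then obtain a\<^sub>0 x\<^sub>0 where p: "p = (a\<^sub>0, x\<^sub>0)" "a\<^sub>0 \<in> pverts G" and x\<^sub>0: "x\<^sub>0 \<in> pverts H"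
      by auto
    \<comment> \<open>The action induced on \<open>G\<close>, read off at the second coordinate of
      \<open>p\<close>; by \<open>fibre\<close> any other second coordinate gives the same
      map.\<close>
    let ?\<tau> = "\<lambda>a. fst (\<sigma> (a, x\<^sub>0))"
    have "pverts G \<subseteq> ?\<tau> ` pverts G"
    proof
      fix b assume "b \<in> pverts G"
      then have "(b, x\<^sub>0) \<in> \<sigma> ` (pverts G \<times> pverts H)"
        using permutes_image[OF perm] x\<^sub>0 by simp
      then obtain a x where "(b, x\<^sub>0) = \<sigma> (a, x)" "a \<in> pverts G" "x \<in> pverts H"
        by auto
      then show "b \<in> ?\<tau> ` pverts G"
        using fibre[of a x\<^sub>0 x] x\<^sub>0 by (metis fst_conv image_eqI)
    qed
    \<comment> \<open>A map of a finite set onto itself is injective.\<close>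
    then have inj: "inj_on ?\<tau> (pverts G)"
      using finG \<sigma>_in x\<^sub>0 by (intro eq_card_imp_inj_on) (auto intro!: arg_cong[where f = card])
    have \<tau>: "?\<tau> a = a" if "a \<in> pverts G" for a
    proof (rule distinguishing_labeling_trivial_on[OF \<phi> finG, where f = ?\<tau>])
      show "(?\<tau> a, ?\<tau> b) \<in> parcs G \<longleftrightarrow> (a, b) \<in> parcs G"
        if ab: "a \<in> pverts G" "b \<in> pverts G" for a b
      proof (cases "a = b")
        case True
        then show ?thesis
          by (simp add: pair_graph_no_loop[OF G])
      next
        case False
        \<comment> \<open>With distinct first coordinates on both sides, arcs of the product are
          exactly arcs of \<open>G\<close>.\<close>
        then have "?\<tau> a \<noteq> ?\<tau> b"
          using inj ab by (auto dest: inj_onD)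
        then show ?thesis
          using graph_automorphismD[OF \<sigma>, of "(a, x\<^sub>0)" "(b, x\<^sub>0)"] False ab x\<^sub>0
            \<sigma>_in[OF ab(1) x\<^sub>0] \<sigma>_in[OF ab(2) x\<^sub>0]
          by (cases "\<sigma> (a, x\<^sub>0)"; cases "\<sigma> (b, x\<^sub>0)") (simp add: parcs_lex_product_iff)
      qed
    qed (use inj that \<sigma>_in x\<^sub>0 lab1 in auto)
    have \<sigma>_eq: "\<sigma> (a\<^sub>0, x) = (a\<^sub>0, snd (\<sigma> (a\<^sub>0, x)))" if "x \<in> pverts H" for x
      using fibre[of a\<^sub>0 x x\<^sub>0] \<tau>[of a\<^sub>0] p(2) that x\<^sub>0 by (metis prod.collapse)
    have "snd (\<sigma> (a\<^sub>0, x\<^sub>0)) = x\<^sub>0"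
    \<comment> \<open>By \<open>\<sigma>_eq\<close> the fibre over \<open>a\<^sub>0\<close> is
      mapped into itself, so \<open>\<sigma>\<close> acts there through its second coordinate. As
      \<open>a\<^sub>0\<close> has no loop, arcs inside the fibre are arcs of
      \<open>H\<close>.\<close>
    proof (rule distinguishing_labeling_trivial_on[OF \<chi> finH, where f = "\<lambda>x. snd (\<sigma> (a\<^sub>0, x))"])
      show "inj_on (\<lambda>x. snd (\<sigma> (a\<^sub>0, x))) (pverts H)"
      proof (rule inj_onI)
        fix x y assume "x \<in> pverts H" "y \<in> pverts H" "snd (\<sigma> (a\<^sub>0, x)) = snd (\<sigma> (a\<^sub>0, y))"
        then have "\<sigma> (a\<^sub>0, x) = \<sigma> (a\<^sub>0, y)"
          using \<sigma>_eq[of x] \<sigma>_eq[of y] by simp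
        then show "x = y"
          using permutes_inj[OF perm] by (auto dest: injD)
      qed
      show "(snd (\<sigma> (a\<^sub>0, x)), snd (\<sigma> (a\<^sub>0, y))) \<in> parcs H \<longleftrightarrow> (x, y) \<in> parcs H"
        if "x \<in> pverts H" "y \<in> pverts H" for x y
        using graph_automorphismD[OF \<sigma>, of "(a\<^sub>0, x)" "(a\<^sub>0, y)"] \<sigma>_eq[of x] \<sigma>_eq[of y]
          that p(2) \<sigma>_in(2)[of a\<^sub>0 x] \<sigma>_in(2)[of a\<^sub>0 y] pair_graph_no_loop[OF G, of a\<^sub>0]
          parcs_lex_product_iff[OF p(2) p(2), of x H y]
          parcs_lex_product_iff[OF p(2) p(2), of "snd (\<sigma> (a\<^sub>0, x))" H "snd (\<sigma> (a\<^sub>0, y))"]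
        by simp
    qed (use p(2) x\<^sub>0 \<sigma>_in lab2 in auto)
    then show ?thesis
      using \<sigma>_eq[OF x\<^sub>0] by (simp add: p)
  qed
qed

section \<open>Upper bound: encoding pairs of labels\<close>

text \<open>The pair of labels is coded in mixed radix: shifted down to start at 0,
  \<open>\<phi> a\<close> is the leading digit and \<open>\<chi> x\<close> the last digit in base
  \<open>s\<close>. The final \<open>+ 1\<close> moves the code back to a range starting at
  1.\<close>

lemma distinguishing_labeling_lex_product:
  assumes G: "pair_graph G" and H: "pair_graph H"
    and \<phi>: "distinguishing_labeling G r \<phi>" and \<chi>: "distinguishing_labeling H s \<chi>"
  shows "distinguishing_labeling (lex_product G H) (r * s) (\<lambda>(a, x). (\<phi> a - 1) * s + (\<chi> x - 1) + 1)"
    (is "distinguishing_labeling _ _ ?\<psi>")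
proof -
  have \<phi>_in: "1 \<le> \<phi> a" "\<phi> a \<le> r" if "a \<in> pverts G" for a
    using \<phi> that by (auto simp: distinguishing_labeling_def Pi_iff)
  have \<chi>_in: "1 \<le> \<chi> x" "\<chi> x \<le> s" if "x \<in> pverts H" for x
    using \<chi> that by (auto simp: distinguishing_labeling_def Pi_iff)
  have range: "?\<psi> (a, x) \<in> {1..r * s}" if "a \<in> pverts G" "x \<in> pverts H" for a x
  proof -
    have "(\<phi> a - 1) * s + (\<chi> x - 1) + 1 \<le> (\<phi> a - 1) * s + s"
      using \<chi>_in[OF that(2)] by simp
    also have "\<dots> = \<phi> a * s"
      using \<phi>_in(1)[OF that(1)] by (simp add: diff_mult_distrib)
    also have "\<dots> \<le> r * s"
      using \<phi>_in(2)[OF that(1)] by simp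
    finally show ?thesis by simp
  qed
  have decode: "\<phi> a = \<phi> b \<and> \<chi> x = \<chi> y"
    if "a \<in> pverts G" "b \<in> pverts G" "x \<in> pverts H" "y \<in> pverts H" "?\<psi> (a, x) = ?\<psi> (b, y)"
    for a b x y
  proof -
    have eq: "(\<phi> a - 1) * s + (\<chi> x - 1) = (\<phi> b - 1) * s + (\<chi> y - 1)"
      using that(5) by simp
    \<comment> \<open>The last digits are below \<open>s\<close>, which also makes \<open>s\<close>
      positive, so \<open>div\<close> and \<open>mod\<close> recover both digits. As labels are at
      least 1, truncated subtraction of 1 loses nothing.\<close>
    have lt: "\<chi> x - 1 < s" "\<chi> y - 1 < s"
      using \<chi>_in[OF that(3)] \<chi>_in[OF that(4)] by auto
    have "\<phi> a - 1 = \<phi> b - 1" "\<chi> x - 1 = \<chi> y - 1"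
      using arg_cong[OF eq, of "\<lambda>n. n div s"] arg_cong[OF eq, of "\<lambda>n. n mod s"] lt by simp_all
    then show ?thesis
      using \<phi>_in(1)[OF that(1)] \<phi>_in(1)[OF that(2)] \<chi>_in(1)[OF that(3)] \<chi>_in(1)[OF that(4)]
      by linarith
  qed
  show ?thesis
    unfolding distinguishing_labeling_def
  proof (intro conjI allI impI)
    show "?\<psi> \<in> pverts (lex_product G H) \<rightarrow> {1..r * s}"
      using range by auto
  next
    fix \<sigma>
    assume \<sigma>: "graph_automorphism (lex_product G H) \<sigma> \<and>
      (\<forall>p\<in>pverts (lex_product G H). ?\<psi> (\<sigma> p) = ?\<psi> p)"
    have "\<phi> (fst (\<sigma> p)) = \<phi> (fst p) \<and> \<chi> (snd (\<sigma> p)) = \<chi> (snd p)"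
      if "p \<in> pverts (lex_product G H)" for p
    proof (rule decode)
      have "\<sigma> p \<in> pverts (lex_product G H)"
        using \<sigma> that by (simp add: permutes_in_image[OF graph_automorphism_permutes]
          del: pverts_lex_product)
      then show "fst (\<sigma> p) \<in> pverts G" "snd (\<sigma> p) \<in> pverts H"
        "fst p \<in> pverts G" "snd p \<in> pverts H"
        using that by auto
      show "?\<psi> (fst (\<sigma> p), snd (\<sigma> p)) = ?\<psi> (fst p, snd p)"
        using bspec[OF conjunct2[OF \<sigma>] that] by (simp only: prod.collapse)
    qed
    then show "\<sigma> = id"
      using lex_product_automorphism_trivial[OF G H \<phi> \<chi> conjunct1[OF \<sigma>]] by blast
  qed
qed

theorem theorem2p1:
  fixes G :: "'a pair_pre_digraph" and H :: "'b pair_pre_digraph"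
  assumes "pair_graph G" and "pair_graph H"
    and "connected (with_proj G)" and "connected (with_proj H)"
  shows "distinguishing_number H \<le> distinguishing_number (lex_product G H) \<and>
    distinguishing_number (lex_product G H) \<le> distinguishing_number G * distinguishing_number H"
proof -
  note fin = pair_graph_finite_pverts
  \<comment> \<open>Connectedness includes having a vertex. The lower bound needs a fibre to
    restrict to: over an empty \<open>G\<close> the product is empty and has distinguishing number
    0.\<close>
  have "pverts G \<noteq> {}"
    using assms(3) by (auto simp: connected_def strongly_connected_def)
  then obtain a where a: "a \<in> pverts G"
    by blast
  obtain \<psi> where "distinguishing_labeling (lex_product G H) (distinguishing_number (lex_product G H)) \<psi>"
    using distinguishing_number_attained[OF fin[OF pair_graph_lex_product]] assms by blast
  then have "distinguishing_number H \<le> distinguishing_number (lex_product G H)"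
    by (intro distinguishing_number_le[OF distinguishing_labeling_lex_product_fibre[OF assms(1,2) a]])
  moreover obtain \<phi> \<chi> where "distinguishing_labeling G (distinguishing_number G) \<phi>"
    and "distinguishing_labeling H (distinguishing_number H) \<chi>"
    using distinguishing_number_attained[OF fin] assms by metis
  then have "distinguishing_number (lex_product G H) \<le> distinguishing_number G * distinguishing_number H"
    by (intro distinguishing_number_le[OF distinguishing_labeling_lex_product[OF assms(1,2)]])
  ultimately show ?thesis ..
qed

end
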